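(* Let $\mathcal S$ be an ISSIFS, $p$ a probability, and $\mathcal M=\{\mathbf M_0=p\mathbf B_0,\dots,\mathbf M_{L-1}=p\mathbf B_{L-1}\}$ the corresponding $N\times N$ expectation matrices. For a matrix $\mathbf M$ let $(\mathbf M)_*=\min_j\sum_i\mathbf M(i,j)$ be its minimal column sum. If $$1<\check{\rho}(\mathcal M)=\lim_{n\to\infty}\check{\rho}_n(\mathcal M,(\cdot)_* ),$$ then the following condition is satisfied for $\mathcal U=\{(1,\dots,1)\}$: there exist $\gamma'>1$ and a level $S'$ such that for all $\boldsymbol\theta\in[L]^{S'}$ there exists a non-negative $|\mathcal U|\times|\mathcal U|$ matrix $\mathbf A_{\boldsymbol\theta}$ with all row sums greater than $\gamma'$ such that $\mathbf U\mathbf M_{\boldsymbol\theta}\ge\mathbf A_{\boldsymbol\theta}\mathbf U$, where $\mathbf U$ is the $|\mathcal U|\times N$ matrix whose rows are the (transposed) elements of $\mathcal U$.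
   Context: Notation: $[k]=\{0,\dots,k-1\}$; $\mathbb N$ includes $0$ when used as a set of values. Inequalities between matrices are entrywise. $(1,\dots,1)\in\mathbb N^N$. ISSIFS: a finite list $\mathcal S=\{S_i(x)=\frac1Lx+t_i\}_{i=0}^{M-1}$ of maps of $\mathbb R$, with $L\ge2$ an integer, $t_i\in\mathbb N$, $0=t_0\le\cdots\le t_{M-1}$, and $L-1$ dividing $t_{M-1}$. On $\Sigma_M=[M]^{\mathbb N}$ put $\Pi(\mathbf i)=\lim_{n\to\infty}S_{i_1}\circ\cdots\circ S_{i_n}(0)$. Let $\eta=\Pi_*\mu$, where $\mu=(\frac1M,\dots,\frac1M)^{\mathbb N}$. The basic intervals are those intervals of the form $[(i-1)L,iL]$, $i\in\mathbb Z$, having positive $\eta$-measure; there are finitely many, say $N$, written $J^{(U)}=[b_UL,(b_U+1)L]$, $U\in[N]$, $b_U\in\mathbb N$, $b_0<b_1<\dots<b_{N-1}$. For $\theta\in[L]$ let $J^{(U)}_\theta=[b_UL+\theta,\,b_UL+\theta+1]$. The $N\times N$ matrix $\mathbf B_\theta$ is $\mathbf B_\theta(i,k)=\#\{\ell\in[M]:S_\ell(J^{(k)})=J^{(i)}_\theta\}$, $i,k\in[N]$. For $\boldsymbol\theta=(\theta_1,\dots,\theta_n)$, $\mathbf M_{\boldsymbol\theta}=\mathbf M_{\theta_1}\cdots\mathbf M_{\theta_n}$. Lower spectral radius: for a function $f$ on matrices (a submultiplicative norm $\|\cdot\|_*$, or $(\cdot)_*$), $\check{\rho}_n(\mathcal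 M,f)=\inf\{f(\mathbf M_{i_1}\cdots\mathbf M_{i_n})^{1/n}:\mathbf M_{i_j}\in\mathcal M,\ 1\le j\le n\}$. The lower spectral radius is $\check{\rho}(\mathcal M)=\lim_{n\to\infty}\check{\rho}_n(\mathcal M,\|\cdot\|_* )$ for a submultiplicative matrix norm $\|\cdot\|_*$. *)

theory Defs
  imports "HOL-Probability.Probability" "Jordan_Normal_Form.Matrix"
begin

no_notation Finite_Cartesian_Product.vec_nth (infixl \<open>$\<close> 90)
hide_const (open) Finite_Cartesian_Product.vec Finite_Cartesian_Product.mat

text \<open>The system is represented by \<open>L\<close> and the list \<open>ts\<close> of translations; its maps are
  \<open>\<lambda>x. x / L + ts ! i\<close> for \<open>i < M\<close>, where \<open>M = length ts\<close>. Repetitions in \<open>ts\<close> are allowed.\<close>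

definition issifs :: "nat \<Rightarrow> nat list \<Rightarrow> bool" where
  "issifs L ts \<longleftrightarrow> L \<ge> 2 \<and> ts \<noteq> [] \<and> ts ! 0 = 0 \<and> sorted ts \<and> (L - 1) dvd last ts"

definition ifs_map :: "nat \<Rightarrow> nat list \<Rightarrow> nat \<Rightarrow> real \<Rightarrow> real" where
  "ifs_map L ts i x = x / real L + real (ts ! i)"

text \<open>Sequences in \<open>\<Sigma>\<^sub>M\<close> are indexed from \<open>0\<close>: the \<open>n\<close>-th approximation is
  \<open>S\<^bsub>\<omega> 0\<^esub> (S\<^bsub>\<omega> 1\<^esub> (\<dots> (S\<^bsub>\<omega> (n-1)\<^esub> 0)))\<close>.\<close>

definition natural_projection :: "nat \<Rightarrow> nat list \<Rightarrow> (nat \<Rightarrow> nat) \<Rightarrow> real" where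
  "natural_projection L ts \<omega> = lim (\<lambda>n. foldr (\<lambda>k. ifs_map L ts (\<omega> k)) [0..<n] 0)"

definition symbolic_measure :: "nat \<Rightarrow> (nat \<Rightarrow> nat) measure" where
  "symbolic_measure M = PiM UNIV (\<lambda>_. uniform_count_measure {..<M})"

definition self_similar_measure :: "nat \<Rightarrow> nat list \<Rightarrow> real measure" where
  "self_similar_measure L ts =
     distr (symbolic_measure (length ts)) borel (natural_projection L ts)"

text \<open>The integers \<open>b\<close> for which \<open>[bL, (b+1)L]\<close> is a basic interval. They range over all of
  \<open>\<int>\<close>: if all translations vanish, the measure is the point mass at \<open>0\<close> and \<open>b = -1\<close> occurs.\<close>

definition basic_indices :: "nat \<Rightarrow> nat list \<Rightarrow> int set" where
  "basic_indices L ts =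
     {b. measure (self_similar_measure L ts) {real_of_int (b * int L)..real_of_int ((b + 1) * int L)} > 0}"

definition num_basic :: "nat \<Rightarrow> nat list \<Rightarrow> nat" where
  "num_basic L ts = card (basic_indices L ts)"

definition basic_index :: "nat \<Rightarrow> nat list \<Rightarrow> nat \<Rightarrow> int" where
  "basic_index L ts U = sorted_list_of_set (basic_indices L ts) ! U"

definition basic_interval :: "nat \<Rightarrow> nat list \<Rightarrow> nat \<Rightarrow> real set" where
  "basic_interval L ts U =
     {real_of_int (basic_index L ts U * int L)..real_of_int ((basic_index L ts U + 1) * int L)}"

definition basic_subinterval :: "nat \<Rightarrow> nat list \<Rightarrow> nat \<Rightarrow> nat \<Rightarrow> real set" where
  "basic_subinterval L ts U \<theta> =
     {real_of_int (basic_index L ts U * int L + int \<theta>)..real_of_int (basic_index L ts U * int L + int \<theta> + 1)}"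

definition B_matrix :: "nat \<Rightarrow> nat list \<Rightarrow> nat \<Rightarrow> real mat" where
  "B_matrix L ts \<theta> = mat (num_basic L ts) (num_basic L ts)
     (\<lambda>(i, k). real (card {l. l < length ts \<and>
        ifs_map L ts l ` basic_interval L ts k = basic_subinterval L ts i \<theta>}))"

definition expectation_matrix :: "nat \<Rightarrow> nat list \<Rightarrow> real \<Rightarrow> nat \<Rightarrow> real mat" where
  "expectation_matrix L ts p \<theta> = p \<cdot>\<^sub>m B_matrix L ts \<theta>"

definition mat_list_prod :: "nat \<Rightarrow> real mat list \<Rightarrow> real mat" where
  "mat_list_prod N As = foldr (*) As (1\<^sub>m N)"

definition submultiplicative_norm :: "nat \<Rightarrow> (real mat \<Rightarrow> real) \<Rightarrow> bool" where
  "submultiplicative_norm N nrm \<longleftrightarrow>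
     (\<forall>A \<in> carrier_mat N N. nrm A \<ge> 0 \<and> (nrm A = 0 \<longleftrightarrow> A = 0\<^sub>m N N)) \<and>
     (\<forall>c. \<forall>A \<in> carrier_mat N N. nrm (c \<cdot>\<^sub>m A) = \<bar>c\<bar> * nrm A) \<and>
     (\<forall>A \<in> carrier_mat N N. \<forall>B \<in> carrier_mat N N. nrm (A + B) \<le> nrm A + nrm B) \<and>
     (\<forall>A \<in> carrier_mat N N. \<forall>B \<in> carrier_mat N N. nrm (A * B) \<le> nrm A * nrm B)"

definition lower_rho :: "nat \<Rightarrow> real mat set \<Rightarrow> (real mat \<Rightarrow> real) \<Rightarrow> nat \<Rightarrow> real" where
  "lower_rho N \<M> f n = (INF As \<in> {As. length As = n \<and> set As \<subseteq> \<M>}. root n (f (mat_list_prod N As)))"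

text \<open>For a submultiplicative norm the limit exists and does not depend on the norm.\<close>

definition lower_spectral_radius :: "nat \<Rightarrow> (real mat \<Rightarrow> real) \<Rightarrow> real mat set \<Rightarrow> real" where
  "lower_spectral_radius N nrm \<M> = lim (lower_rho N \<M> nrm)"

definition min_col_sum :: "real mat \<Rightarrow> real" where
  "min_col_sum A = Min ((\<lambda>j. \<Sum>i<dim_row A. A $$ (i, j)) ` {..<dim_col A})"

text \<open>The finite set \<open>\<U>\<close> is enumerated by a list \<open>us\<close> to form the matrix whose rows are its
  elements; the condition does not depend on the enumeration. The order on matrices is entrywise.\<close>

definition growth_condition :: "nat \<Rightarrow> nat \<Rightarrow> (nat \<Rightarrow> real mat) \<Rightarrow> nat vec set \<Rightarrow> bool" where
  "growth_condition L N Ms \<U> \<longleftrightarrow>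
     (\<exists>us. distinct us \<and> set us = \<U> \<and>
       (let U = map_mat real (mat_of_rows N us) in
        \<exists>\<gamma> > 1. \<exists>S \<ge> 1. \<forall>\<theta>s. length \<theta>s = S \<and> set \<theta>s \<subseteq> {..<L} \<longrightarrow>
          (\<exists>A \<in> carrier_mat (card \<U>) (card \<U>).
             (\<forall>i < card \<U>. \<forall>j < card \<U>. A $$ (i, j) \<ge> 0) \<and>
             (\<forall>i < card \<U>. (\<Sum>j < card \<U>. A $$ (i, j)) > \<gamma>) \<and>
             U * mat_list_prod N (map Ms \<theta>s) \<ge> A * U)))"

end

theory Submission
  imports Defs
begin

text \<open>For the single row vector \<open>u = (1,\<dots>,1)\<close> the entries of \<open>u P\<close> are the column sums of
  \<open>P\<close>, so the best scalar \<open>a\<close> with \<open>u P \<ge> a u\<close> is the minimal column sum of \<open>P\<close>. The condition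
  to be shown therefore asks for one level at which all products have minimal column sum
  greater than one common constant \<open>\<gamma> > 1\<close> (\<open>growth_condition_ones_of_min_col_sum\<close>).

  The normalised minimal column sums at level \<open>n\<close> have infimum \<open>lower_rho N \<M> min_col_sum n\<close>,
  and these infima converge to a limit \<open>\<rho> > 1\<close>. Fix \<open>\<gamma>\<close> strictly between \<open>1\<close> and \<open>\<rho>\<close>. At
  some level \<open>n \<ge> 1\<close> the infimum exceeds \<open>\<gamma>\<close>, so every product of length \<open>n\<close> has minimal column
  sum greater than \<open>\<gamma> ^ n \<ge> \<gamma>\<close>.\<close>

lemma mat_list_prod_carrier:
  assumes "set As \<subseteq> carrier_mat N N"
  shows "mat_list_prod N As \<in> carrier_mat N N"
  using assms unfolding mat_list_prod_def by (induction As) auto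

lemma min_col_sum_le:
  assumes "j < dim_col A"
  shows "min_col_sum A \<le> (\<Sum>i<dim_row A. A $$ (i, j))"
  unfolding min_col_sum_def using assms by (intro Min_le) auto

text \<open>Finiteness of the family makes the infimum one over finitely many products, hence a genuine
  lower bound for each of them.\<close>

lemma lower_rho_le:
  assumes "finite \<M>" "length As = n" "set As \<subseteq> \<M>"
  shows "lower_rho N \<M> f n \<le> root n (f (mat_list_prod N As))"
proof -
  have "finite {As. length As = n \<and> set As \<subseteq> \<M>}"
    using finite_lists_length_eq[OF assms(1), of n] by (simp add: conj_commute)
  then show ?thesis
    unfolding lower_rho_def using assms by (intro cINF_lower) auto
qed

lemma less_of_less_root:
  fixes g x :: real
  assumes "1 \<le> g" "g < root n x" "n \<ge> 1"
  shows "g < x"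
proof -
  have "x > 0"
    using assms real_root_gt_0_iff[of n x] by linarith
  then have "x = root n x ^ n"
    using assms by simp
  moreover have "root n x \<le> root n x ^ n"
    using self_le_power[of "root n x" n] assms by linarith
  ultimately show ?thesis
    using assms by linarith
qed

text \<open>The witness for a word is the \<open>1 \<times> 1\<close> matrix holding the minimal column sum of its product.
  For \<open>N = 0\<close> that sum is an unspecified real, and the matrix inequality has no entries.\<close>

lemma growth_condition_ones_of_min_col_sum:
  assumes carrier: "\<And>\<theta>. \<theta> < L \<Longrightarrow> Ms \<theta> \<in> carrier_mat N N"
    and "\<gamma> > 1" "n \<ge> 1"
    and large: "\<And>\<theta>s. length \<theta>s = n \<Longrightarrow> set \<theta>s \<subseteq> {..<L} \<Longrightarrow>
                  \<gamma> < min_col_sum (mat_list_prod N (map Ms \<theta>s))"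
  shows "growth_condition L N Ms {Matrix.vec N (\<lambda>_. 1)}"
proof -
  define U where "U = map_mat real (mat_of_rows N [Matrix.vec N (\<lambda>_. 1)])"
  have U: "U \<in> carrier_mat 1 N" "\<And>j. j < N \<Longrightarrow> U $$ (0, j) = 1"
    by (auto simp: U_def mat_of_rows_def)
  have "\<exists>A \<in> carrier_mat 1 1. A $$ (0, 0) \<ge> 0 \<and> A $$ (0, 0) > \<gamma> \<and>
          U * mat_list_prod N (map Ms \<theta>s) \<ge> A * U"
    if word: "length \<theta>s = n \<and> set \<theta>s \<subseteq> {..<L}" for \<theta>s
  proof -
    define P where "P = mat_list_prod N (map Ms \<theta>s)"
    define A where "A = Matrix.mat 1 1 (\<lambda>_. min_col_sum P)"
    have P: "P \<in> carrier_mat N N"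
      unfolding P_def using word carrier by (intro mat_list_prod_carrier) auto
    have "\<gamma> < min_col_sum P"
      using word large unfolding P_def by blast
    moreover have "A * U \<le> U * P"
    proof -
      have "(A * U) $$ (0, j) \<le> (U * P) $$ (0, j)" if "j < N" for j
      proof -
        have "(A * U) $$ (0, j) = min_col_sum P"
          using U that by (simp add: A_def scalar_prod_def)
        also have "\<dots> \<le> (\<Sum>i<N. P $$ (i, j))"
          using min_col_sum_le[of j P] P that by simp
        also have "\<dots> = (U * P) $$ (0, j)"
          using U P that by (simp add: scalar_prod_def lessThan_atLeast0)
        finally show ?thesis .
      qed
      then show ?thesis
        using U P by (auto simp: less_eq_mat_def A_def)
    qed
    ultimately show ?thesis
      using \<open>\<gamma> > 1\<close> unfolding P_def[symmetric]
      by (intro bexI[of _ A]) (auto simp: A_def)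
  qed
  then have words: "\<forall>\<theta>s. length \<theta>s = n \<and> set \<theta>s \<subseteq> {..<L} \<longrightarrow>
      (\<exists>A \<in> carrier_mat (card {one}) (card {one}).
         (\<forall>i < card {one}. \<forall>j < card {one}. A $$ (i, j) \<ge> 0) \<and>
         (\<forall>i < card {one}. (\<Sum>j < card {one}. A $$ (i, j)) > \<gamma>) \<and>
         U * mat_list_prod N (map Ms \<theta>s) \<ge> A * U)" for one :: "nat vec"
    by simp
  have "distinct [one] \<and> set [one] = {one}" for one :: "nat vec"
    by simp
  with \<open>\<gamma> > 1\<close> \<open>n \<ge> 1\<close> words show ?thesis
    unfolding growth_condition_def Let_def U_def by blast
qed

theorem corollary7p3:
  fixes L :: nat and ts :: "nat list" and p :: real and nrm :: "real mat \<Rightarrow> real"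
    and N :: nat and M :: "nat \<Rightarrow> real mat" and \<M> :: "real mat set"
  assumes "issifs L ts"
    and "0 \<le> p" "p \<le> 1"
    and N_def: "N = num_basic L ts"
    and M_def: "M = expectation_matrix L ts p"
    and MM_def: "\<M> = M ` {..<L}"
    and "submultiplicative_norm N nrm"
    and "1 < lower_spectral_radius N nrm \<M>"
    and "lower_rho N \<M> min_col_sum \<longlonglongrightarrow> lower_spectral_radius N nrm \<M>"
  shows "growth_condition L N M {Matrix.vec N (\<lambda>_. 1)}"
proof -
  obtain \<gamma> where \<gamma>: "1 < \<gamma>" "\<gamma> < lower_spectral_radius N nrm \<M>"
    using assms(8) dense by blast
  have "\<forall>\<^sub>F n in sequentially. \<gamma> < lower_rho N \<M> min_col_sum n \<and> n \<ge> 1"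
    using order_tendstoD(1)[OF assms(9) \<gamma>(2)] eventually_ge_at_top[of 1]
    by (rule eventually_conj)
  then obtain n where n: "\<gamma> < lower_rho N \<M> min_col_sum n" "n \<ge> 1"
    using eventually_happens'[OF sequentially_bot] by blast
  show ?thesis
  proof (rule growth_condition_ones_of_min_col_sum[OF _ \<gamma>(1) n(2)])
    show "M \<theta> \<in> carrier_mat N N" for \<theta>
      by (simp add: M_def N_def expectation_matrix_def B_matrix_def)
  next
    fix \<theta>s :: "nat list"
    assume word: "length \<theta>s = n" "set \<theta>s \<subseteq> {..<L}"
    then have "lower_rho N \<M> min_col_sum n \<le> root n (min_col_sum (mat_list_prod N (map M \<theta>s)))"
      by (intro lower_rho_le) (auto simp: MM_def)
    with n(1) have "\<gamma> < root n (min_col_sum (mat_list_prod N (map M \<theta>s)))"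
      by linarith
    then show "\<gamma> < min_col_sum (mat_list_prod N (map M \<theta>s))"
      using \<gamma>(1) n(2) less_of_less_root less_imp_le by blast
  qed
qed

end
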